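(* For every constant $c>0$ there is a constant $a>0$ depending only on $c$ such that for all integers $S\ge2$ and $n\ge cS$, and every function $g$ of the empirical distribution with $g(P_n)\in\mathbb{R}^S$, where $g$ does not depend on $Q$, $$\sup_{P,Q\in\mathcal{M}_S}\mathbb{E}_P\Big(\|g(P_n)-Q\|_1-\|P-Q\|_1\Big)^2\ge a\,\frac Sn .$$
   Context: $\mathcal{M}_S$ is the set of probability vectors on $\{1,\dots,S\}$; $\|x-y\|_1=\sum_{i=1}^S|x_i-y_i|$. Poisson sampling model with $Q$ known: for $P=(p_i)$ one observes mutually independent $X_i\sim\mathrm{Poi}(np_i)$, $1\le i\le S$, and $P_n=(X_1/n,\dots,X_S/n)$ is the empirical distribution. *)

theory Defs
  imports "HOL-Probability.Probability"
begin

(* Vectors of R^S are functions nat => real whose coordinates are those with index in {1..S}. *)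

definition prob_vectors :: "nat \<Rightarrow> (nat \<Rightarrow> real) set" where
  "prob_vectors S =
     {p. (\<forall>i\<in>{1..S}. 0 \<le> p i) \<and> (\<forall>i. i \<notin> {1..S} \<longrightarrow> p i = 0) \<and> (\<Sum>i=1..S. p i) = 1}"

definition l1_dist :: "nat \<Rightarrow> (nat \<Rightarrow> real) \<Rightarrow> (nat \<Rightarrow> real) \<Rightarrow> real" where
  "l1_dist S x y = (\<Sum>i=1..S. \<bar>x i - y i\<bar>)"

(* poisson_pmf is only specified for positive rates; Poi(0) is the point mass at 0. *)
definition Poi :: "real \<Rightarrow> nat pmf" where
  "Poi r = (if r = 0 then return_pmf 0 else poisson_pmf r)"

(* Joint law of the independent counts X_1, ..., X_S; indices outside {1..S} carry the value 0. *)
definition poisson_sample :: "nat \<Rightarrow> nat \<Rightarrow> (nat \<Rightarrow> real) \<Rightarrow> (nat \<Rightarrow> nat) pmf" where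
  "poisson_sample S n p = Pi_pmf {1..S} 0 (\<lambda>i. Poi (real n * p i))"

definition empirical :: "nat \<Rightarrow> (nat \<Rightarrow> nat) \<Rightarrow> nat \<Rightarrow> real" where
  "empirical n X = (\<lambda>i. real (X i) / real n)"

(* The expectation is taken in [0, \<infinity>], since g is arbitrary and the risk may be infinite. *)
definition l1_risk ::
    "nat \<Rightarrow> nat \<Rightarrow> ((nat \<Rightarrow> real) \<Rightarrow> nat \<Rightarrow> real) \<Rightarrow> (nat \<Rightarrow> real) \<Rightarrow> (nat \<Rightarrow> real) \<Rightarrow> ennreal" where
  "l1_risk S n g P Q =
     (\<integral>\<^sup>+ X. ennreal ((l1_dist S (g (empirical n X)) Q - l1_dist S P Q)\<^sup>2)
        \<partial>measure_pmf (poisson_sample S n P))"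

end

theory Submission
  imports Defs
begin

text \<open>
  Already the diagonal \<open>Q = P\<close> forces the bound. There the distance to be estimated is \<open>0\<close>, and the
  loss is \<open>\<parallel>g(P\<^sub>n) - P\<parallel>\<^sub>1\<^sup>2\<close>: since \<open>g\<close> must work for every \<open>Q\<close>, it has to be
  a good estimator of \<open>P\<close> itself in \<open>\<ell>\<^sub>1\<close>, and that costs \<open>S/n\<close> in squared loss.

  The cost is bounded below by Assouad's method. Let \<open>m = S div 2\<close>, and match each of the first \<open>m\<close>
  coordinates with one of the next \<open>m\<close>. Start from mass \<open>1/(2m)\<close> on each, and for a subset \<open>J\<close> of
  \<open>{1..m}\<close> move \<open>d/(2m)\<close> within each pair, in the direction that \<open>J\<close> prescribes; moving mass only
  within pairs keeps the total equal to \<open>1\<close>. Choose \<open>d\<close> as a small multiple of \<open>sqrt (m/n)\<close>. Switching one pair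
  multiplies the likelihood by \<open>((1 - d)/(1 + d))\<^sup>k\<close>, where \<open>k\<close> is, up to sign, the difference
  of the two counts (\<open>pmf_poisson_sample_toggle_ge\<close>). By the Poisson variance this difference is
  of order \<open>sqrt (n/m)\<close>, hence a small multiple of \<open>1/d\<close>, so the sample cannot tell
  the two directions apart, and \<open>g\<close> errs by order \<open>d/m\<close> on that coordinate for at least one of them
  (\<open>coordinate_error_toggle_ge\<close>). Summing over the \<open>m\<close> pairs and averaging over all \<open>J\<close> gives a \<open>J\<close>
  with expected \<open>\<ell>\<^sub>1\<close> error of order \<open>d\<close>, and Cauchy--Schwarz turns this into a squared
  loss of order \<open>d\<^sup>2\<close>, that is \<open>S/n\<close>. The condition \<open>n \<ge> c S\<close> is what permits \<open>d < 1\<close> with a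
  constant depending on \<open>c\<close> alone.

  All integrals are taken in \<open>[0, \<infinity>]\<close>, so an estimator without moments needs no separate treatment.
\<close>

section \<open>The Poisson variance\<close>

text \<open>
  The factorial moments come from the exponential series by shifting the index, and
  \<open>(k - r)\<^sup>2 = k (k - 1) + (1 - 2 r) k + r\<^sup>2\<close> reduces the variance to them.
\<close>

lemma poisson_pmf_variance:
  assumes "r > 0"
  shows "(\<integral>\<^sup>+ k. ennreal ((real k - r)\<^sup>2) \<partial>measure_pmf (poisson_pmf r)) = ennreal r"
proof -
  have s0: "(\<lambda>k. r ^ k / fact k) sums exp r"
    using exp_converges[of r] by (simp add: scaleR_conv_of_real field_simps)
  have step: "real (Suc k) * (r ^ Suc k / fact (Suc k)) = r * (r ^ k / fact k)" for k
    by (simp add: divide_simps)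
  have "(\<lambda>k. real (Suc k) * (r ^ Suc k / fact (Suc k))) sums (r * exp r)"
    unfolding step by (rule sums_mult[OF s0])
  hence s1: "(\<lambda>k. real k * (r ^ k / fact k)) sums (r * exp r)"
    by (subst (asm) sums_Suc_iff) simp
  have "(\<lambda>k. real k * (real (Suc k) * (r ^ Suc k / fact (Suc k)))) sums (r * (r * exp r))"
    unfolding step using sums_mult[OF s1, of r] by (simp add: algebra_simps)
  hence "(\<lambda>k. (real (Suc k) - 1) * real (Suc k) * (r ^ Suc k / fact (Suc k)))
      sums (r * (r * exp r))"
    by (simp add: algebra_simps)
  hence s2: "(\<lambda>k. (real k - 1) * real k * (r ^ k / fact k)) sums (r * (r * exp r))"
    by (subst (asm) sums_Suc_iff) simp
  have "(\<lambda>k. ((real k - 1) * real k * (r ^ k / fact k) +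
               ((1 - 2 * r) * (real k * (r ^ k / fact k)) + r\<^sup>2 * (r ^ k / fact k))) * exp (- r))
      sums ((r * (r * exp r) + ((1 - 2 * r) * (r * exp r) + r\<^sup>2 * exp r)) * exp (- r))"
    by (intro sums_mult2 sums_add sums_mult s0 s1 s2)
  also have "(r * (r * exp r) + ((1 - 2 * r) * (r * exp r) + r\<^sup>2 * exp r)) * exp (- r) = r"
    by (simp add: exp_minus field_simps power2_eq_square)
  also have "(\<lambda>k. ((real k - 1) * real k * (r ^ k / fact k) +
               ((1 - 2 * r) * (real k * (r ^ k / fact k)) + r\<^sup>2 * (r ^ k / fact k))) * exp (- r))
      = (\<lambda>k. pmf (poisson_pmf r) k * (real k - r)\<^sup>2)"
    using assms by (intro ext) (simp add: algebra_simps power2_eq_square add_divide_distrib diff_divide_distrib)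
  finally have "(\<lambda>k. pmf (poisson_pmf r) k * (real k - r)\<^sup>2) sums r" .
  hence "(\<Sum>k. ennreal (pmf (poisson_pmf r) k * (real k - r)\<^sup>2)) = ennreal r"
    by (intro suminf_ennreal_eq) auto
  thus ?thesis
    by (simp add: nn_integral_measure_pmf nn_integral_count_space_nat ennreal_mult'
             del: pmf_poisson)
qed

text \<open>
  A count deviates from its rate by about the square root of that rate. The scale \<open>2 d\<close> is that of the
  log-likelihood ratio below, and the hypothesis \<open>d\<^sup>2 (n p\<^sub>i) \<le> 1/256\<close> says that one standard
  deviation is small on it.
\<close>

lemma nn_integral_scaled_abs_deviation_le:
  assumes "0 \<le> d" "0 < n * p i" "i \<in> {1..S}" "d\<^sup>2 * (n * p i) \<le> 1 / 256"
  shows "(\<integral>\<^sup>+ X. ennreal (2 * d * \<bar>real (X i) - n * p i\<bar>)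
            \<partial>measure_pmf (poisson_sample S n p)) \<le> ennreal (1 / 8)"
proof -
  define r where "r = n * p i"
  have r: "r > 0" "d\<^sup>2 * r \<le> 1 / 256" using assms by (auto simp: r_def)
  have marginal: "map_pmf (\<lambda>X. X i) (poisson_sample S n p) = poisson_pmf r"
  proof -
    have "Poi (real n * p i) = poisson_pmf r" using r(1) by (auto simp: Poi_def r_def)
    thus ?thesis using assms(3) by (simp add: poisson_sample_def Pi_pmf_component)
  qed
  \<comment> \<open>The weights balance: under the hypothesis on \<open>d\<close> both terms contribute at most 1/16 in expectation.\<close>
  have young: "2 * d * \<bar>y\<bar> \<le> 16 * d\<^sup>2 * y\<^sup>2 + 1 / 16" for y :: real
    using zero_le_power2[of "4 * d * \<bar>y\<bar> - 1 / 4"]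
    by (simp add: power2_eq_square algebra_simps)
  have "(\<integral>\<^sup>+ X. ennreal (2 * d * \<bar>real (X i) - r\<bar>) \<partial>measure_pmf (poisson_sample S n p))
      = (\<integral>\<^sup>+ k. ennreal (2 * d * \<bar>real k - r\<bar>) \<partial>measure_pmf (poisson_pmf r))"
    by (simp flip: marginal)
  also have "\<dots> \<le> (\<integral>\<^sup>+ k. ennreal (16 * d\<^sup>2) * ennreal ((real k - r)\<^sup>2) + ennreal (1 / 16)
      \<partial>measure_pmf (poisson_pmf r))"
    by (intro nn_integral_mono)
      (simp add: young ennreal_leI flip: ennreal_mult ennreal_plus)
  also have "\<dots> = ennreal (16 * d\<^sup>2) * ennreal r + ennreal (1 / 16)"
    by (simp add: nn_integral_add nn_integral_cmult poisson_pmf_variance[OF r(1)])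
  also have "\<dots> = ennreal (16 * d\<^sup>2 * r + 1 / 16)"
    using r by (simp add: ennreal_mult ennreal_plus)
  also have "\<dots> \<le> ennreal (1 / 8)" using r by (intro ennreal_leI) simp
  finally show ?thesis by (simp add: r_def)
qed

section \<open>Two-point lower bounds\<close>

lemma power_ge_power_mult_Bernoulli:
  fixes u v e :: real
  assumes "0 < u" "0 < v" "u - v \<le> e * u" "0 \<le> e"
  shows "u ^ k * (1 - e * real k) \<le> v ^ k"
proof -
  have "1 - e * real k \<le> 1 + real k * ((v - u) / u)"
  proof -
    have "- e \<le> (v - u) / u" using assms by (simp add: field_simps)
    from mult_left_mono[OF this, of "real k"] show ?thesis by (simp add: algebra_simps)
  qed
  also have "\<dots> \<le> (1 + (v - u) / u) ^ k"
    using assms by (intro Bernoulli_inequality) (simp add: field_simps)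
  also have "\<dots> = v ^ k / u ^ k" using assms by (simp add: field_simps power_divide)
  finally show ?thesis using assms by (simp add: field_simps)
qed

text \<open>
  Up to a common factor, \<open>u ^ a * v ^ b\<close> is the likelihood of the counts \<open>a\<close> and \<open>b\<close> under rates
  proportional to \<open>u\<close> and \<open>v\<close>. Exchanging the rates changes it by \<open>(v/u)\<close> to the power \<open>a - b\<close>,
  and Bernoulli's inequality linearises that power. The bound is linear in \<open>\<bar>a - b\<bar>\<close> so that
  the absolute deviations of the two counts, each computed from its own marginal law, control it.
\<close>

lemma swapped_powers_ge:
  fixes u v e :: real
  assumes "0 < u" "0 < v" "u - v \<le> e * u" "v - u \<le> e * v" "0 \<le> e"
  shows "u ^ a * v ^ b * (1 - e * \<bar>real a - real b\<bar>) \<le> v ^ a * u ^ b"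
proof (cases "b \<le> a")
  case True
  then obtain k where k: "a = b + k" using le_Suc_ex by blast
  have "(u * v) ^ b * (u ^ k * (1 - e * real k)) \<le> (u * v) ^ b * v ^ k"
    using assms by (intro mult_left_mono power_ge_power_mult_Bernoulli) auto
  thus ?thesis by (simp add: k power_add power_mult_distrib mult_ac)
next
  case False
  then obtain k where k: "b = a + k" using le_Suc_ex by (metis nat_le_linear)
  have "(u * v) ^ a * (v ^ k * (1 - e * real k)) \<le> (u * v) ^ a * u ^ k"
    using assms by (intro mult_left_mono power_ge_power_mult_Bernoulli) auto
  thus ?thesis by (simp add: k power_add power_mult_distrib mult_ac)
qed

text \<open>
  Le Cam's two-point bound. The hypotheses make \<open>max 0 (1 - h)\<close> times the law \<open>M\<close> a common part of
  both laws, of mass at least \<open>1/2\<close>. On the common part \<open>f\<close> pays \<open>\<bar>f x - s\<bar> + \<bar>f x - t\<bar>\<close>, which is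
  at least \<open>\<bar>s - t\<bar>\<close>.
\<close>

lemma nn_integral_two_point_ge:
  fixes M N :: "'a pmf" and f h :: "'a \<Rightarrow> real"
  assumes dom: "\<And>x. pmf M x * (1 - h x) \<le> pmf N x"
    and h: "\<And>x. 0 \<le> h x"
    and small: "(\<integral>\<^sup>+ x. ennreal (h x) \<partial>measure_pmf M) \<le> ennreal (1 / 2)"
  shows "ennreal (\<bar>s - t\<bar> / 2)
    \<le> (\<integral>\<^sup>+ x. ennreal \<bar>f x - s\<bar> \<partial>measure_pmf M) + (\<integral>\<^sup>+ x. ennreal \<bar>f x - t\<bar> \<partial>measure_pmf N)"
proof -
  \<comment> \<open>\<open>ennreal\<close> sends negative reals to 0, so this weight is the positive part of \<open>1 - h\<close>.\<close>
  define w where "w = (\<lambda>x. ennreal (1 - h x))"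
  have w: "ennreal (1 / 2) \<le> (\<integral>\<^sup>+ x. w x \<partial>measure_pmf M)" (is "_ \<le> ?W")
  proof -
    have "1 = (\<integral>\<^sup>+ x. 1 \<partial>measure_pmf M)" by simp
    also have "\<dots> \<le> (\<integral>\<^sup>+ x. w x + ennreal (h x) \<partial>measure_pmf M)"
    proof (intro nn_integral_mono)
      fix x
      show "1 \<le> w x + ennreal (h x)"
        using h[of x] unfolding w_def
        by (cases "h x \<le> 1") (auto simp flip: ennreal_plus simp: ennreal_neg)
    qed
    also have "\<dots> = ?W + (\<integral>\<^sup>+ x. ennreal (h x) \<partial>measure_pmf M)"
      by (intro nn_integral_add) auto
    also have "\<dots> \<le> ?W + ennreal (1 / 2)" by (intro add_left_mono small)
    finally have *: "1 \<le> ?W + ennreal (1 / 2)" .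
    show ?thesis
    proof (cases ?W)
      case (real r)
      have "ennreal 1 \<le> ennreal (r + 1 / 2)"
        using * real by (simp add: ennreal_plus)
      hence "1 \<le> r + 1 / 2" using real by (subst (asm) ennreal_le_iff) auto
      hence "1 / 2 \<le> r" by simp
      thus ?thesis unfolding real(2) by (rule ennreal_leI)
    qed simp
  qed
  have transfer_N: "(\<integral>\<^sup>+ x. w x * F x \<partial>measure_pmf M) \<le> (\<integral>\<^sup>+ x. F x \<partial>measure_pmf N)"
    for F :: "'a \<Rightarrow> ennreal"
    unfolding nn_integral_measure_pmf
  proof (intro nn_integral_mono)
    fix x
    have "ennreal (pmf M x) * w x \<le> ennreal (pmf N x)"
      unfolding w_def by (subst ennreal_mult'[symmetric]) (auto intro: ennreal_leI dom)
    from mult_right_mono[OF this, of "F x"]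
    show "ennreal (pmf M x) * (w x * F x) \<le> ennreal (pmf N x) * F x" by (simp add: mult_ac)
  qed
  have "ennreal (\<bar>s - t\<bar> / 2) = ennreal \<bar>s - t\<bar> * ennreal (1 / 2)"
    using ennreal_mult[of "\<bar>s - t\<bar>" "1 / 2"] by (simp only: abs_ge_zero) simp
  also have "\<dots> \<le> ennreal \<bar>s - t\<bar> * ?W" by (intro mult_left_mono w) auto
  also have "\<dots> = (\<integral>\<^sup>+ x. w x * ennreal \<bar>s - t\<bar> \<partial>measure_pmf M)"
    by (simp add: nn_integral_multc mult.commute)
  also have "\<dots> \<le> (\<integral>\<^sup>+ x. ennreal \<bar>f x - s\<bar> + w x * ennreal \<bar>f x - t\<bar> \<partial>measure_pmf M)"
  proof (intro nn_integral_mono)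
    fix x
    have "w x \<le> 1" using h[of x] by (simp add: w_def)
    have "w x * ennreal \<bar>s - t\<bar> \<le> w x * (ennreal \<bar>f x - s\<bar> + ennreal \<bar>f x - t\<bar>)"
      by (intro mult_left_mono) (auto simp flip: ennreal_plus intro!: ennreal_leI)
    also have "\<dots> = w x * ennreal \<bar>f x - s\<bar> + w x * ennreal \<bar>f x - t\<bar>"
      by (simp add: distrib_left)
    also have "\<dots> \<le> ennreal \<bar>f x - s\<bar> + w x * ennreal \<bar>f x - t\<bar>"
      using mult_right_mono[OF \<open>w x \<le> 1\<close>, of "ennreal \<bar>f x - s\<bar>"]
      by (intro add_right_mono) simp
    finally show "w x * ennreal \<bar>s - t\<bar> \<le> ennreal \<bar>f x - s\<bar> + w x * ennreal \<bar>f x - t\<bar>" .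
  qed
  also have "\<dots> = (\<integral>\<^sup>+ x. ennreal \<bar>f x - s\<bar> \<partial>measure_pmf M)
      + (\<integral>\<^sup>+ x. w x * ennreal \<bar>f x - t\<bar> \<partial>measure_pmf M)"
    by (intro nn_integral_add) auto
  also have "\<dots> \<le> (\<integral>\<^sup>+ x. ennreal \<bar>f x - s\<bar> \<partial>measure_pmf M)
      + (\<integral>\<^sup>+ x. ennreal \<bar>f x - t\<bar> \<partial>measure_pmf N)"
    by (intro add_left_mono transfer_N)
  finally show ?thesis .
qed

section \<open>A hypercube of perturbations of the uniform distribution\<close>

definition toggle :: "'a \<Rightarrow> 'a set \<Rightarrow> 'a set" where
  "toggle j J = (if j \<in> J then J - {j} else insert j J)"

lemma toggle_toggle [simp]: "toggle j (toggle j J) = J"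
  by (auto simp: toggle_def)

lemma mem_toggle_iff: "i \<in> toggle j J \<longleftrightarrow> (if i = j then j \<notin> J else i \<in> J)"
  by (auto simp: toggle_def)

lemma sum_Pow_toggle:
  assumes "j \<in> A"
  shows "(\<Sum>J\<in>Pow A. f (toggle j J)) = (\<Sum>J\<in>Pow A. f J)"
  using assms
  by (intro sum.reindex_bij_witness[where i = "toggle j" and j = "toggle j"])
    (auto simp: toggle_def split: if_splits)

text \<open>
  The vertex \<open>J\<close> of the hypercube records in which direction mass is moved between the paired
  coordinates \<open>i\<close> and \<open>i + m\<close>; a pair keeps its total mass \<open>1/m\<close> either way.
\<close>

definition perturbed_uniform :: "nat \<Rightarrow> real \<Rightarrow> nat set \<Rightarrow> nat \<Rightarrow> real" where
  "perturbed_uniform m d J i =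
     (if i \<in> {1..m} then (if i \<in> J then 1 + d else 1 - d) / (2 * real m)
      else if i \<in> {m+1..2*m} then (if i - m \<in> J then 1 - d else 1 + d) / (2 * real m)
      else 0)"

lemma perturbed_uniform_prob_vector:
  assumes "1 \<le> m" "2 * m \<le> S" "0 \<le> d" "d \<le> 1"
  shows "perturbed_uniform m d J \<in> prob_vectors S"
proof -
  let ?p = "perturbed_uniform m d J"
  have "(\<Sum>i=1..S. ?p i) = (\<Sum>i\<in>{1..m} \<union> {m+1..2*m}. ?p i)"
    using assms by (intro sum.mono_neutral_right) (auto simp: perturbed_uniform_def)
  also have "\<dots> = (\<Sum>i\<in>{1..m}. ?p i) + (\<Sum>i\<in>{m+1..2*m}. ?p i)"
    by (intro sum.union_disjoint) auto
  also have "(\<Sum>i\<in>{m+1..2*m}. ?p i) = (\<Sum>i\<in>{1..m}. ?p (i + m))"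
    by (intro sum.reindex_bij_witness[where i = "\<lambda>i. i + m" and j = "\<lambda>i. i - m"]) auto
  also have "(\<Sum>i\<in>{1..m}. ?p i) + (\<Sum>i\<in>{1..m}. ?p (i + m)) = (\<Sum>i\<in>{1..m}. 1 / real m)"
    unfolding sum.distrib[symmetric] using assms
    by (intro sum.cong) (auto simp: perturbed_uniform_def field_simps)
  also have "\<dots> = 1" using assms by simp
  finally show ?thesis
    using assms by (auto simp: prob_vectors_def perturbed_uniform_def)
qed

text \<open>
  Membership of \<open>j\<close> in \<open>J\<close> affects only the rates at \<open>j\<close> and \<open>j + m\<close>, and toggling it exchanges the
  two. Their sum is unchanged, so the exponential factors cancel in the likelihood ratio and only
  the swapped powers remain.
\<close>

lemma pmf_poisson_sample_toggle_ge:
  assumes "j \<in> {1..m}" "2 * m \<le> S" "0 \<le> d" "d < 1" "1 \<le> n"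
  shows "pmf (poisson_sample S n (perturbed_uniform m d J)) X
           * (1 - 2 * d * \<bar>real (X j) - real (X (j + m))\<bar>)
       \<le> pmf (poisson_sample S n (perturbed_uniform m d (toggle j J))) X"
proof (cases "\<forall>i. i \<notin> {1..S} \<longrightarrow> X i = 0")
  case False
  thus ?thesis by (auto simp: poisson_sample_def pmf_Pi)
next
  case True
  let ?p = "perturbed_uniform m d J" and ?q = "perturbed_uniform m d (toggle j J)"
  let ?e = "\<lambda>p i. pmf (Poi (real n * p i)) (X i)"
  have j: "j \<in> {1..S}" "j + m \<in> {1..S} - {j}" using assms by auto
  have split: "pmf (poisson_sample S n p) X
      = ?e p j * ?e p (j + m) * (\<Prod>i\<in>{1..S} - {j} - {j + m}. ?e p i)" for p
    unfolding poisson_sample_def using True j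
    by (subst pmf_Pi') (auto simp: prod.remove[of _ j] prod.remove[of _ "j + m"] mult_ac)
  have rest: "(\<Prod>i\<in>{1..S} - {j} - {j + m}. ?e ?q i) = (\<Prod>i\<in>{1..S} - {j} - {j + m}. ?e ?p i)"
  proof (intro prod.cong refl)
    fix i assume "i \<in> {1..S} - {j} - {j + m}"
    hence "?q i = ?p i" by (auto simp: perturbed_uniform_def mem_toggle_iff)
    thus "?e ?q i = ?e ?p i" by simp
  qed
  define l where "l = real n / (2 * real m)"
  define u where "u = (if j \<in> J then 1 + d else 1 - d)"
  define v where "v = (if j \<in> J then 1 - d else 1 + d)"
  have uv: "0 < u" "0 < v" and l: "0 < l" using assms by (auto simp: u_def v_def l_def)
  have rates: "real n * ?p j = l * u" "real n * ?p (j + m) = l * v"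
      "real n * ?q j = l * v" "real n * ?q (j + m) = l * u"
    using assms by (auto simp: perturbed_uniform_def mem_toggle_iff u_def v_def l_def)
  have Poi: "pmf (Poi (l * s)) k = l ^ k / fact k * exp (- (l * s)) * s ^ k" if "0 < s" for s k
    using that l by (simp add: Poi_def power_mult_distrib)
  define C where "C = l ^ X j / fact (X j) * (l ^ X (j + m) / fact (X (j + m)))
    * exp (- (l * u)) * exp (- (l * v))"
  have C: "0 \<le> C" using l by (simp add: C_def)
  have pairs: "?e ?p j * ?e ?p (j + m) = C * (u ^ X j * v ^ X (j + m))"
      "?e ?q j * ?e ?q (j + m) = C * (v ^ X j * u ^ X (j + m))"
    unfolding rates Poi[OF uv(1)] Poi[OF uv(2)] C_def by (simp_all add: mult_ac)
  have "u ^ X j * v ^ X (j + m) * (1 - 2 * d * \<bar>real (X j) - real (X (j + m))\<bar>)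
      \<le> v ^ X j * u ^ X (j + m)"
  proof (rule swapped_powers_ge)
    have "d * d \<le> d" using assms mult_left_le[of d d] by simp
    thus "u - v \<le> 2 * d * u" "v - u \<le> 2 * d * v"
      using assms by (auto simp: u_def v_def algebra_simps)
  qed (use uv assms in auto)
  from mult_left_mono[OF this C]
  have "?e ?p j * ?e ?p (j + m) * (1 - 2 * d * \<bar>real (X j) - real (X (j + m))\<bar>)
      \<le> ?e ?q j * ?e ?q (j + m)"
    unfolding pairs by (simp add: mult_ac)
  from mult_right_mono[OF this, of "\<Prod>i\<in>{1..S} - {j} - {j + m}. ?e ?p i"]
  show ?thesis unfolding split rest by (simp add: mult_ac prod_nonneg)
qed

text \<open>
  The hypothesis \<open>d\<^sup>2 n \<le> m/256\<close> makes the perturbation too small to be seen in a single pair: the two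
  counts deviate from their rates by at most \<open>1/8\<close> each in expectation, and the rates differ by at
  most \<open>1/4\<close>, all measured on the scale \<open>2 d\<close>, which adds up to the \<open>1/2\<close> that the two-point bound tolerates.
\<close>

lemma coordinate_error_toggle_ge:
  fixes G :: "(nat \<Rightarrow> nat) \<Rightarrow> real"
  assumes "j \<in> {1..m}" "2 * m \<le> S" "0 \<le> d" "d < 1" "1 \<le> n" "d\<^sup>2 * real n \<le> real m / 256"
  defines "p \<equiv> perturbed_uniform m d"
  shows "ennreal (d / (2 * real m))
    \<le> (\<integral>\<^sup>+ X. ennreal \<bar>G X - p J j\<bar> \<partial>measure_pmf (poisson_sample S n (p J)))
      + (\<integral>\<^sup>+ X. ennreal \<bar>G X - p (toggle j J) j\<bar>
           \<partial>measure_pmf (poisson_sample S n (p (toggle j J))))"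
proof -
  let ?M = "measure_pmf (poisson_sample S n (p J))"
  let ?r = "\<lambda>i. real n * p J i"
  have m: "0 < real m" using assms by simp
  have dn: "d\<^sup>2 * real n / real m \<le> 1 / 256" using assms(6) m by (simp add: field_simps)
  have rate: "0 < ?r i \<and> d\<^sup>2 * ?r i \<le> 1 / 256" if "i = j \<or> i = j + m" for i
  proof -
    have p: "0 < p J i" "p J i \<le> 1 / real m"
      using that assms by (auto simp: p_def perturbed_uniform_def divide_simps)
    have "d\<^sup>2 * ?r i \<le> d\<^sup>2 * (real n * (1 / real m))"
      using p by (intro mult_left_mono) auto
    also have "\<dots> \<le> 1 / 256" using dn by simp
    finally show ?thesis using p assms by simp
  qed
  have gap: "2 * d * \<bar>?r j - ?r (j + m)\<bar> \<le> 1 / 4"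
  proof -
    have "\<bar>p J j - p J (j + m)\<bar> = d / real m"
      using assms by (auto simp: p_def perturbed_uniform_def field_simps abs_if)
    hence "\<bar>?r j - ?r (j + m)\<bar> = real n * (d / real m)"
      by (metis abs_mult abs_of_nat right_diff_distrib)
    hence "2 * d * \<bar>?r j - ?r (j + m)\<bar> = 2 * (d\<^sup>2 * real n / real m)"
      by (simp add: power2_eq_square)
    thus ?thesis using dn by linarith
  qed
  have "(\<integral>\<^sup>+ X. ennreal (2 * d * \<bar>real (X j) - real (X (j + m))\<bar>) \<partial>?M)
      \<le> (\<integral>\<^sup>+ X. ennreal (2 * d * \<bar>real (X j) - ?r j\<bar>)
          + (ennreal (2 * d * \<bar>real (X (j + m)) - ?r (j + m)\<bar>) + ennreal (1 / 4)) \<partial>?M)"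
  proof (intro nn_integral_mono)
    fix X :: "nat \<Rightarrow> nat"
    have "2 * d * \<bar>real (X j) - real (X (j + m))\<bar>
        \<le> 2 * d * (\<bar>real (X j) - ?r j\<bar> + (\<bar>real (X (j + m)) - ?r (j + m)\<bar> + \<bar>?r j - ?r (j + m)\<bar>))"
      using assms by (intro mult_left_mono) auto
    also have "\<dots> \<le> 2 * d * \<bar>real (X j) - ?r j\<bar>
        + (2 * d * \<bar>real (X (j + m)) - ?r (j + m)\<bar> + 1 / 4)"
      using gap by (simp add: distrib_left)
    finally show "ennreal (2 * d * \<bar>real (X j) - real (X (j + m))\<bar>)
      \<le> ennreal (2 * d * \<bar>real (X j) - ?r j\<bar>)
          + (ennreal (2 * d * \<bar>real (X (j + m)) - ?r (j + m)\<bar>) + ennreal (1 / 4))"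
      using assms by (simp add: ennreal_leI flip: ennreal_plus)
  qed
  also have "\<dots> = (\<integral>\<^sup>+ X. ennreal (2 * d * \<bar>real (X j) - ?r j\<bar>) \<partial>?M)
      + ((\<integral>\<^sup>+ X. ennreal (2 * d * \<bar>real (X (j + m)) - ?r (j + m)\<bar>) \<partial>?M) + ennreal (1 / 4))"
    by (simp add: nn_integral_add)
  also have "\<dots> \<le> ennreal (1 / 8) + (ennreal (1 / 8) + ennreal (1 / 4))"
    using rate assms by (intro add_mono nn_integral_scaled_abs_deviation_le) auto
  also have "\<dots> = ennreal (1 / 2)" by (simp flip: ennreal_plus)
  finally have small: "(\<integral>\<^sup>+ X. ennreal (2 * d * \<bar>real (X j) - real (X (j + m))\<bar>) \<partial>?M)
      \<le> ennreal (1 / 2)" .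
  have "\<bar>p J j - p (toggle j J) j\<bar> = d / real m"
    using assms by (auto simp: p_def perturbed_uniform_def mem_toggle_iff field_simps abs_if)
  hence gap_j: "d / (2 * real m) = \<bar>p J j - p (toggle j J) j\<bar> / 2" by simp
  show ?thesis
    unfolding gap_j
  proof (intro nn_integral_two_point_ge[OF _ _ small])
    show "0 \<le> 2 * d * \<bar>real (X j) - real (X (j + m))\<bar>" for X :: "nat \<Rightarrow> nat"
      using assms(3) by simp
  qed (unfold p_def, rule pmf_poisson_sample_toggle_ge[OF assms(1-5)])
qed

section \<open>The minimax lower bound\<close>

text \<open>
  Assouad's averaging step. Toggling \<open>j\<close> permutes the subsets of \<open>{1..m}\<close>, so the sum over all of them
  of the error at coordinate \<open>j\<close> is half the sum of the two-point errors. On average over \<open>J\<close>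
  each of the \<open>m\<close> coordinates therefore contributes at least \<open>d/(4m)\<close>.
\<close>

lemma ex_perturbed_uniform_expected_l1_ge:
  fixes G :: "(nat \<Rightarrow> nat) \<Rightarrow> nat \<Rightarrow> real"
  assumes "1 \<le> m" "2 * m \<le> S" "0 \<le> d" "d < 1" "1 \<le> n" "d\<^sup>2 * real n \<le> real m / 256"
  defines "p \<equiv> perturbed_uniform m d"
  obtains J where "ennreal (d / 4)
    \<le> (\<integral>\<^sup>+ X. ennreal (l1_dist S (G X) (p J)) \<partial>measure_pmf (poisson_sample S n (p J)))"
proof -
  define err where
    "err J j = (\<integral>\<^sup>+ X. ennreal \<bar>G X j - p J j\<bar> \<partial>measure_pmf (poisson_sample S n (p J)))" for J j
  define Y where
    "Y J = (\<integral>\<^sup>+ X. ennreal (l1_dist S (G X) (p J)) \<partial>measure_pmf (poisson_sample S n (p J)))" for J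
  let ?V = "Pow {1..m}"
  have coords: "(\<Sum>j=1..m. err J j) \<le> Y J" for J
  proof -
    have "(\<Sum>j=1..m. err J j)
        = (\<integral>\<^sup>+ X. (\<Sum>j=1..m. ennreal \<bar>G X j - p J j\<bar>) \<partial>measure_pmf (poisson_sample S n (p J)))"
      unfolding err_def by (intro nn_integral_sum[symmetric]) auto
    also have "\<dots> \<le> Y J"
      unfolding Y_def l1_dist_def using assms(2)
      by (intro nn_integral_mono) (auto intro!: ennreal_leI sum_mono2)
    finally show ?thesis .
  qed
  \<comment> \<open>The worst vertex is at least as bad as the average one.\<close>
  have "finite (Y ` ?V)" "Y ` ?V \<noteq> {}" by auto
  from Max_in[OF this] obtain J where J: "Y J = Max (Y ` ?V)" by auto
  have max: "Y K \<le> Y J" if "K \<in> ?V" for K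
    unfolding J using that by (intro Max_ge) auto
  have "ennreal (real (card ?V) * (d / 2)) = ennreal (\<Sum>j=1..m. \<Sum>K\<in>?V. d / (2 * real m))"
    using assms(1) by (simp add: field_simps)
  also have "\<dots> = (\<Sum>j=1..m. \<Sum>K\<in>?V. ennreal (d / (2 * real m)))"
    using assms(3) by (simp del: sum_constant add: sum_nonneg)
  also have "\<dots> \<le> (\<Sum>j=1..m. \<Sum>K\<in>?V. err K j + err (toggle j K) j)"
    unfolding err_def p_def using assms
    by (intro sum_mono coordinate_error_toggle_ge) auto
  also have "\<dots> = (\<Sum>j=1..m. 2 * (\<Sum>K\<in>?V. err K j))"
    by (intro sum.cong refl) (simp add: sum.distrib sum_Pow_toggle[where f = "\<lambda>K. err K _"] mult_2)
  also have "\<dots> = 2 * (\<Sum>K\<in>?V. \<Sum>j=1..m. err K j)"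
    unfolding sum_distrib_left[symmetric] by (rule arg_cong[OF sum.swap])
  also have "\<dots> \<le> 2 * (\<Sum>K\<in>?V. Y J)"
    by (intro mult_left_mono sum_mono order.trans[OF coords max]) auto
  also have "\<dots> = 2 * (of_nat (card ?V) * Y J)" by simp
  finally have avg: "ennreal (real (card ?V) * (d / 2)) \<le> 2 * (of_nat (card ?V) * Y J)" .
  have "ennreal (d / 4) \<le> Y J"
  proof (cases "Y J")
    case (real y)
    have "2 * (of_nat (card ?V) * Y J) = ennreal (real (card ?V) * (2 * y))"
      using real by (simp add: ennreal_mult ennreal_of_nat_eq_real_of_nat mult_ac)
    with avg have "real (card ?V) * (d / 2) \<le> real (card ?V) * (2 * y)"
      using real by (simp add: ennreal_le_iff)
    hence "d / 2 \<le> 2 * y" by (simp add: card_Pow)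
    thus ?thesis using real by (simp add: ennreal_leI)
  qed simp
  thus ?thesis using that unfolding Y_def by blast
qed

lemma l1_risk_diagonal_ge:
  assumes "0 \<le> t"
    and "ennreal t \<le> (\<integral>\<^sup>+ X. ennreal (l1_dist S (g (empirical n X)) P)
                          \<partial>measure_pmf (poisson_sample S n P))"
  shows "ennreal (t\<^sup>2) \<le> l1_risk S n g P P"
proof -
  let ?f = "\<lambda>X. l1_dist S (g (empirical n X)) P"
  have nonneg: "0 \<le> ?f X" for X by (simp add: l1_dist_def sum_nonneg)
  have "ennreal (t\<^sup>2) = (ennreal t)\<^sup>2" using assms(1) by (simp add: ennreal_power)
  also have "\<dots> \<le> (\<integral>\<^sup>+ X. ennreal (?f X) * 1 \<partial>measure_pmf (poisson_sample S n P))\<^sup>2"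
    using assms(2) by (intro power_mono) auto
  also have "\<dots> \<le> (\<integral>\<^sup>+ X. (ennreal (?f X))\<^sup>2 \<partial>measure_pmf (poisson_sample S n P))
      * (\<integral>\<^sup>+ X. 1\<^sup>2 \<partial>measure_pmf (poisson_sample S n P))"
    by (intro Cauchy_Schwarz_nn_integral) auto
  also have "\<dots> = l1_risk S n g P P"
    by (simp add: l1_risk_def l1_dist_def[of S P P] ennreal_power nonneg)
  finally show ?thesis .
qed

theorem lemma8:
  shows "\<forall>c::real. c > 0 \<longrightarrow> (\<exists>a::real. a > 0 \<and>
    (\<forall>(S::nat) (n::nat) (g :: (nat \<Rightarrow> real) \<Rightarrow> nat \<Rightarrow> real).
       S \<ge> 2 \<longrightarrow> real n \<ge> c * real S \<longrightarrow>
       (SUP (P, Q) \<in> prob_vectors S \<times> prob_vectors S. l1_risk S n g P Q)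
         \<ge> ennreal (a * (real S / real n))))"
proof (intro allI impI)
  fix c :: real
  assume c: "c > 0"
  define k where "k = min (1 / 256) c"
  have k: "0 < k" "k \<le> 1 / 256" "k \<le> c" using c by (auto simp: k_def)
  show "\<exists>a::real. a > 0 \<and>
    (\<forall>(S::nat) (n::nat) (g :: (nat \<Rightarrow> real) \<Rightarrow> nat \<Rightarrow> real).
       S \<ge> 2 \<longrightarrow> real n \<ge> c * real S \<longrightarrow>
       (SUP (P, Q) \<in> prob_vectors S \<times> prob_vectors S. l1_risk S n g P Q)
         \<ge> ennreal (a * (real S / real n)))"
  \<comment> \<open>The squared error is at least \<open>(d / 4)\<^sup>2 = (k / 16) (m / n)\<close>, and \<open>S \<le> 3 m\<close>.\<close>
  proof (intro exI[of _ "k / 48"] conjI allI impI)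
    show "k / 48 > 0" using k by simp
  next
    fix S n :: nat and g :: "(nat \<Rightarrow> real) \<Rightarrow> nat \<Rightarrow> real"
    assume S: "S \<ge> 2" and n: "real n \<ge> c * real S"
    have "0 < c * real S" using c S by simp
    with n have n0: "0 < real n" by linarith
    define m where "m = S div 2"
    have m: "1 \<le> m" "2 * m \<le> S" "S \<le> 3 * m" using S by (auto simp: m_def)
    \<comment> \<open>The two bounds on \<open>k\<close> serve different ends: \<open>k \<le> 1/256\<close> makes neighbouring vertices
      indistinguishable, and \<open>k \<le> c\<close> with \<open>n \<ge> c S\<close> gives \<open>d < 1\<close>, so that all rates are positive.\<close>
    define d where "d = sqrt (k * real m / real n)"
    have d2: "d\<^sup>2 = k * real m / real n" using k n0 by (simp add: d_def)
    have "2 * (k * real m) \<le> c * real S"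
      using mult_mono[of k c "2 * real m" "real S"] k m c by simp
    hence "d\<^sup>2 < 1\<^sup>2" using n n0 k m unfolding d2 by (simp add: field_simps)
    hence d: "0 \<le> d" "d < 1"
      using k n0 by (auto simp: d_def intro: power_less_imp_less_base)
    have "k * real m \<le> real m / 256" using k mult_right_mono[of k "1 / 256" "real m"] by simp
    hence dn: "d\<^sup>2 * real n \<le> real m / 256" using n0 by (simp add: d2)
    have "1 \<le> n" using n0 by simp
    obtain J where J: "ennreal (d / 4)
      \<le> (\<integral>\<^sup>+ X. ennreal (l1_dist S (g (empirical n X)) (perturbed_uniform m d J))
           \<partial>measure_pmf (poisson_sample S n (perturbed_uniform m d J)))"
      by (rule ex_perturbed_uniform_expected_l1_ge
          [OF m(1,2) d \<open>1 \<le> n\<close> dn, where G = "\<lambda>X. g (empirical n X)"])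
    let ?P = "perturbed_uniform m d J"
    have P: "?P \<in> prob_vectors S" using m d by (intro perturbed_uniform_prob_vector) auto
    have "k / 48 * (real S / real n) \<le> k / 48 * (3 * real m / real n)"
      using m k n0 by (intro mult_left_mono divide_right_mono) auto
    also have "\<dots> = (d / 4)\<^sup>2" by (simp add: power_divide d2)
    finally have "ennreal (k / 48 * (real S / real n)) \<le> ennreal ((d / 4)\<^sup>2)"
      by (rule ennreal_leI)
    also have "\<dots> \<le> l1_risk S n g ?P ?P" using d J by (intro l1_risk_diagonal_ge) auto
    also have "\<dots> \<le> (SUP (P, Q) \<in> prob_vectors S \<times> prob_vectors S. l1_risk S n g P Q)"
      using P by (intro SUP_upper2[of "(?P, ?P)"]) auto
    finally show "ennreal (k / 48 * (real S / real n))
      \<le> (SUP (P, Q) \<in> prob_vectors S \<times> prob_vectors S. l1_risk S n g P Q)" .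
  qed
qed

end
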